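(* Let $G$ be a graph of order $n\ge 2$ with no isolated vertex. Then the following hold. 1. Bounds: $2\le \chi_i(G)\le n$. 2. Upper bound: $\chi_i(G)=n$ if and only if $G=K_n$. 3. Lower bound: every star $K_{1,n-1}$ satisfies $\chi_i=2$. If $G$ is not a star, then the following statements are equivalent: - (i) $\chi_i(G)=2$; - (ii) $G$ is a bipartite graph having Property $\Im_1$ or Property $\Im_2$ (for some bipartition); - (iii) $G\in\mathcal{F}_1\cup\mathcal{F}_2\cup\mathcal{F}_3$.
   Context: All graphs are finite, simple, undirected and connected. Neighborhoods and private neighbors. $N(v)$ denotes the open neighborhood and $N[v]=N(v)\cup\{v\}$ the closed neighborhood of $v$. For $S\subseteq V(G)$, $N[S]=\bigcup_{v\in S}N[v]$. For $v\in S$, $pn[v,S]=N[v]\setminus N[S\setminus\{v\}]$. Irredundance. A set $S$ is irredundant if $pn[v,S]\neq\emptyset$ for all $v\in S$. It is maximal irredundant if $S$ is irredundant and $S\cup\{w\}$ is not irredundant for every $w\notin S$. Irredundance coloring. An irredundance coloring is a proper coloring for which some maximal irredundant set $R$ has all its vertices colored pairwise differently. $\chi_i(G)$ is the minimum number of colors in an irredundance coloring. Bipartite graphs. Write $G(V_1,V_2)$ for a bipartite graph with bipartition $V_1,V_2$. Property $\Im_1$. $G(V_1,V_2)$ has Property $\Im_1$ if there exist adjacent vertices $v_1\in V_1$, $v_2\in V_2$ with $\deg(v_1)\ge 2$ and $\deg(v_2)\ge 2$ such that: - (a) every vertex of $V_2\setminus N(v_1)$ is adjacent to every vertex of $N(v_2)\setminus\{v_1\}$;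 - (b) every vertex of $V_1\setminus N(v_2)$ is adjacent to every vertex of $N(v_1)\setminus\{v_2\}$; - (c) for $\{i,j\}=\{1,2\}$, if $\deg(v_i)\ge 3$ then every $x\in N(v_i)$ satisfies at least one of: $x$ is a pendant vertex, $N(x)\subseteq N(v_j)$, or $N(x)=V_i$. Property $\Im_2$. $G(V_1,V_2)$ has Property $\Im_2$ if there exist non-adjacent $v_1\in V_1$, $v_2\in V_2$ with $N(v_1)=V_2\setminus\{v_2\}$ and $N(v_2)=V_1\setminus\{v_1\}$. Family $\mathcal{F}_1$. Let $K$ be the graph obtained from two stars, centered at $v_1$ and at $x$ and each having at least one leaf, together with a new vertex $v_2$ joined to both $v_1$ and $x$. $\mathcal{F}_1$ consists of the bipartite graphs obtained from some such $K$ by joining $x$ to some (possibly none, possibly all) of the vertices of $N_K(v_1)$. Family $\mathcal{F}_2$. $\mathcal{F}_2$ consists of the bipartite graphs $G(V_1,V_2)$ having $v_1\in V_1$, $v_2\in V_2$ with $N(v_1)=V_2$ and $N(v_2)=V_1$. Family $\mathcal{F}_3$. $\mathcal{F}_3$ consists of the bipartite graphs $G(V_1,V_2)$ having non-adjacent $v_1\in V_1$, $v_2\in V_2$ with $N(v_1)=V_2\setminus\{v_2\}$ and $N(v_2)=V_1\setminus\{v_1\}$. *)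

theory Defs
  imports "Graph_Theory.Graph_Theory"
begin

(* Finite simple undirected graphs are symmetric loop-free digraphs without parallel arcs
   (locale graph); u and v are adjacent iff (u, v) \<in> arcs_ends G. *)

definition nbh :: "('a, 'b) pre_digraph \<Rightarrow> 'a \<Rightarrow> 'a set" where
  "nbh G v = {u. v \<rightarrow>\<^bsub>G\<^esub> u}"

definition closed_nbh :: "('a, 'b) pre_digraph \<Rightarrow> 'a \<Rightarrow> 'a set" where
  "closed_nbh G v = insert v (nbh G v)"

definition closed_nbh_set :: "('a, 'b) pre_digraph \<Rightarrow> 'a set \<Rightarrow> 'a set" where
  "closed_nbh_set G S = (\<Union>v\<in>S. closed_nbh G v)"

definition deg :: "('a, 'b) pre_digraph \<Rightarrow> 'a \<Rightarrow> nat" where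
  "deg G v = card (nbh G v)"

definition private_nbh :: "('a, 'b) pre_digraph \<Rightarrow> 'a \<Rightarrow> 'a set \<Rightarrow> 'a set" where
  "private_nbh G v S = closed_nbh G v - closed_nbh_set G (S - {v})"

definition irredundant :: "('a, 'b) pre_digraph \<Rightarrow> 'a set \<Rightarrow> bool" where
  "irredundant G S \<longleftrightarrow> S \<subseteq> verts G \<and> (\<forall>v\<in>S. private_nbh G v S \<noteq> {})"

definition maximal_irredundant :: "('a, 'b) pre_digraph \<Rightarrow> 'a set \<Rightarrow> bool" where
  "maximal_irredundant G S \<longleftrightarrow>
     irredundant G S \<and> (\<forall>w\<in>verts G - S. \<not> irredundant G (S \<union> {w}))"

definition proper_coloring :: "('a, 'b) pre_digraph \<Rightarrow> ('a \<Rightarrow> nat) \<Rightarrow> bool" where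
  "proper_coloring G c \<longleftrightarrow> (\<forall>u v. u \<rightarrow>\<^bsub>G\<^esub> v \<longrightarrow> c u \<noteq> c v)"

definition irredundance_coloring :: "('a, 'b) pre_digraph \<Rightarrow> ('a \<Rightarrow> nat) \<Rightarrow> bool" where
  "irredundance_coloring G c \<longleftrightarrow>
     proper_coloring G c \<and> (\<exists>R. maximal_irredundant G R \<and> inj_on c R)"

definition irredundance_chromatic_number :: "('a, 'b) pre_digraph \<Rightarrow> nat" (\<open>\<chi>\<^sub>i\<close>) where
  "\<chi>\<^sub>i G = (LEAST k. \<exists>c. irredundance_coloring G c \<and> card (c ` verts G) = k)"

(* The minimum in the previous definition is over a nonempty set. *)
lemma (in graph) irredundance_coloring_exists: "\<exists>c. irredundance_coloring G c"
proof -
  have "finite {S. irredundant G S}"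
    by (rule finite_subset[of _ "Pow (verts G)"]) (auto simp: irredundant_def)
  moreover have "{} \<in> {S. irredundant G S}" by (simp add: irredundant_def)
  ultimately obtain R where R: "irredundant G R"
    and max: "\<And>S. irredundant G S \<Longrightarrow> R \<subseteq> S \<Longrightarrow> R = S"
    using finite_has_maximal[of "{S. irredundant G S}"] by blast
  have "maximal_irredundant G R"
    using R max by (auto simp: maximal_irredundant_def)
  moreover obtain c :: "'a \<Rightarrow> nat" where c: "inj_on c (verts G)"
    using finite_imp_inj_to_nat_seg[OF finite_verts] by blast
  moreover have "proper_coloring G c"
    unfolding proper_coloring_def
    by (metis adj_in_verts adj_not_same c inj_onD)
  moreover have "inj_on c R"
    using c R by (auto simp: irredundant_def intro: inj_on_subset)
  ultimately show ?thesis by (auto simp: irredundance_coloring_def)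
qed

definition bipartition :: "('a, 'b) pre_digraph \<Rightarrow> 'a set \<Rightarrow> 'a set \<Rightarrow> bool" where
  "bipartition G V1 V2 \<longleftrightarrow>
     verts G = V1 \<union> V2 \<and> V1 \<inter> V2 = {} \<and> arcs_ends G \<subseteq> V1 \<times> V2 \<union> V2 \<times> V1"

definition property_Im1 :: "('a, 'b) pre_digraph \<Rightarrow> 'a set \<Rightarrow> 'a set \<Rightarrow> bool" where
  "property_Im1 G V1 V2 \<longleftrightarrow>
     (\<exists>v1\<in>V1. \<exists>v2\<in>V2. v1 \<rightarrow>\<^bsub>G\<^esub> v2 \<and> 2 \<le> deg G v1 \<and> 2 \<le> deg G v2 \<and>
        (\<forall>y\<in>V2 - nbh G v1. \<forall>x\<in>nbh G v2 - {v1}. y \<rightarrow>\<^bsub>G\<^esub> x) \<and>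
        (\<forall>y\<in>V1 - nbh G v2. \<forall>x\<in>nbh G v1 - {v2}. y \<rightarrow>\<^bsub>G\<^esub> x) \<and>
        (3 \<le> deg G v1 \<longrightarrow>
           (\<forall>x\<in>nbh G v1. deg G x = 1 \<or> nbh G x \<subseteq> nbh G v2 \<or> nbh G x = V1)) \<and>
        (3 \<le> deg G v2 \<longrightarrow>
           (\<forall>x\<in>nbh G v2. deg G x = 1 \<or> nbh G x \<subseteq> nbh G v1 \<or> nbh G x = V2)))"

definition property_Im2 :: "('a, 'b) pre_digraph \<Rightarrow> 'a set \<Rightarrow> 'a set \<Rightarrow> bool" where
  "property_Im2 G V1 V2 \<longleftrightarrow>
     (\<exists>v1\<in>V1. \<exists>v2\<in>V2. \<not> v1 \<rightarrow>\<^bsub>G\<^esub> v2 \<and>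
        nbh G v1 = V2 - {v2} \<and> nbh G v2 = V1 - {v1})"

(* Adjacency relation of the graph K on {v1, v2, x} \<union> A \<union> B: a star with centre v1 and leaf set A,
   a star with centre x and leaf set B, and the vertex v2 joined to both centres. *)
definition linked_stars :: "'a \<Rightarrow> 'a set \<Rightarrow> 'a \<Rightarrow> 'a \<Rightarrow> 'a set \<Rightarrow> ('a \<times> 'a) set" where
  "linked_stars v1 A v2 x B = symcl ({v1} \<times> A \<union> {x} \<times> B \<union> {v2} \<times> {v1, x})"

(* linked_stars v1 A v2 x B `` {v1} is the neighbourhood of v1 in K. *)
definition family_F1 :: "('a, 'b) pre_digraph set" where
  "family_F1 = {G. graph G \<and> (\<exists>V1 V2. bipartition G V1 V2) \<and>
     (\<exists>v1 v2 x A B S. distinct [v1, v2, x] \<and> A \<noteq> {} \<and> B \<noteq> {} \<and>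
        A \<inter> B = {} \<and> (A \<union> B) \<inter> {v1, v2, x} = {} \<and>
        S \<subseteq> linked_stars v1 A v2 x B `` {v1} \<and>
        verts G = {v1, v2, x} \<union> A \<union> B \<and>
        arcs_ends G = linked_stars v1 A v2 x B \<union> symcl ({x} \<times> S))}"

definition family_F2 :: "('a, 'b) pre_digraph set" where
  "family_F2 = {G. graph G \<and> (\<exists>V1 V2. bipartition G V1 V2 \<and>
     (\<exists>v1\<in>V1. \<exists>v2\<in>V2. nbh G v1 = V2 \<and> nbh G v2 = V1))}"

definition family_F3 :: "('a, 'b) pre_digraph set" where
  "family_F3 = {G. graph G \<and> (\<exists>V1 V2. bipartition G V1 V2 \<and>
     (\<exists>v1\<in>V1. \<exists>v2\<in>V2. \<not> v1 \<rightarrow>\<^bsub>G\<^esub> v2 \<and>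
        nbh G v1 = V2 - {v2} \<and> nbh G v2 = V1 - {v1}))}"

end

theory Submission
  imports Defs
begin

text \<open>
  If \<open>R\<close> is maximal irredundant and \<open>w \<notin> R\<close>, then \<open>w\<close> may share its colour with any non-neighbour;
  so \<open>\<chi>\<^sub>i = n\<close> forces \<open>w\<close> to be dominating, hence \<open>{w}\<close> to be maximal irredundant, hence every other
  vertex to be dominating as well.

  A colouring with two colours is a bipartition together with a maximal irredundant set meeting each
  side at most once: a single dominating vertex (the graph is then a star) or a pair \<open>{v1, v2}\<close>. An
  independent set is maximal irredundant iff it is dominating, which for a non-adjacent pair is
  \<open>property_Im2\<close>. For an adjacent pair write \<open>V1 = {v1} \<union> near1 \<union> far1\<close> and
  \<open>V2 = {v2} \<union> near2 \<union> far2\<close>, where \<open>near1\<close> and \<open>near2\<close> consist of the other neighbours of \<open>v2\<close> and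
  \<open>v1\<close>. Both \<open>property_Im1\<close> and maximal irredundance of the pair say that \<open>near1\<close> and \<open>near2\<close> are
  nonempty, that \<open>far1\<close> is complete to \<open>near2\<close> and \<open>far2\<close> to \<open>near1\<close>, and that either \<open>near1\<close> is
  complete to \<open>near2\<close> or \<open>(far1 = {} \<or> card near2 = 1) \<and> (far2 = {} \<or> card near1 = 1)\<close>. If \<open>near1\<close> is
  complete to \<open>near2\<close>, or both far sets are empty, the graph is in \<open>family_F2\<close>; if exactly one is
  empty, it is in \<open>family_F1\<close>; otherwise \<open>near1\<close> and \<open>near2\<close> are single non-adjacent vertices, and the
  graph is in \<open>family_F3\<close>.
\<close>

lemma mem_nbh: "u \<in> nbh G v \<longleftrightarrow> v \<rightarrow>\<^bsub>G\<^esub> u"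
  by (simp add: nbh_def)

lemma mem_symcl_iff: "(u, v) \<in> symcl R \<longleftrightarrow> (u, v) \<in> R \<or> (v, u) \<in> R"
  by (force simp: symcl_def)

lemma mem_private_nbh_iff:
  "u \<in> private_nbh G v S \<longleftrightarrow> u \<in> closed_nbh G v \<and> (\<forall>w\<in>S - {v}. u \<notin> closed_nbh G w)"
  by (auto simp: private_nbh_def closed_nbh_set_def)

lemma bipartition_swap: "bipartition G V1 V2 \<Longrightarrow> bipartition G V2 V1"
  by (auto simp: bipartition_def)

lemma card_eq_1_iff_subset_singleton:
  assumes "w \<in> A"
  shows "card A = 1 \<longleftrightarrow> A \<subseteq> {w}"
  using assms by (auto simp: card_1_singleton_iff subset_singleton_iff)

definition independent_set :: "('a, 'b) pre_digraph \<Rightarrow> 'a set \<Rightarrow> bool" where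
  "independent_set G S \<longleftrightarrow> S \<subseteq> verts G \<and> (\<forall>v\<in>S. nbh G v \<inter> S = {})"

definition dominating_set :: "('a, 'b) pre_digraph \<Rightarrow> 'a set \<Rightarrow> bool" where
  "dominating_set G S \<longleftrightarrow> S \<subseteq> verts G \<and> closed_nbh_set G S = verts G"

definition complete_to :: "('a, 'b) pre_digraph \<Rightarrow> 'a set \<Rightarrow> 'a set \<Rightarrow> bool" where
  "complete_to G X Y \<longleftrightarrow> (\<forall>x\<in>X. Y \<subseteq> nbh G x)"

lemma maximal_irredundant_subset_verts: "maximal_irredundant G R \<Longrightarrow> R \<subseteq> verts G"
  by (simp add: maximal_irredundant_def irredundant_def)

lemma irredundance_chromatic_number_le:
  assumes "irredundance_coloring G c"
  shows "\<chi>\<^sub>i G \<le> card (c ` verts G)"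
  unfolding irredundance_chromatic_number_def using assms by (auto intro: Least_le)

section \<open>Neighbourhoods\<close>

lemma (in graph) nbh_commute: "u \<in> nbh G v \<longleftrightarrow> v \<in> nbh G u"
  using graph_symmetric by (auto simp only: mem_nbh)

lemma (in graph) not_mem_nbh_self [simp]: "v \<notin> nbh G v"
  using adj_not_same by (auto simp only: mem_nbh)

lemma (in graph) nbh_subset_verts: "nbh G v \<subseteq> verts G"
  using adj_in_verts by (auto simp only: mem_nbh)

lemma (in graph) finite_nbh [simp]: "finite (nbh G v)"
  by (rule finite_subset[OF nbh_subset_verts finite_verts])

lemma (in graph) closed_nbh_subset_verts: "v \<in> verts G \<Longrightarrow> closed_nbh G v \<subseteq> verts G"
  using nbh_subset_verts by (auto simp: closed_nbh_def)

lemma (in graph) deg_eq_Suc_card: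
  assumes "u \<in> nbh G v"
  shows "deg G v = Suc (card (nbh G v - {u}))"
  unfolding deg_def using card_Suc_Diff1[OF finite_nbh assms] ..

lemma (in graph) complete_to_commute: "complete_to G X Y \<longleftrightarrow> complete_to G Y X"
  unfolding complete_to_def using nbh_commute by blast

lemma (in graph) complete_digraph_iff:
  "complete_digraph (card (verts G)) G \<longleftrightarrow> (\<forall>v\<in>verts G. nbh G v = verts G - {v})"
proof -
  have "arcs_ends G = {(u, v). u \<in> verts G \<and> v \<in> nbh G u}"
    using adj_in_verts by (auto simp only: mem_nbh)
  then have "arcs_ends G = {(u, v). (u, v) \<in> verts G \<times> verts G \<and> u \<noteq> v} \<longleftrightarrow>
      (\<forall>v\<in>verts G. nbh G v = verts G - {v})"
    by (simp add: set_eq_iff) metis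
  then show ?thesis
    using graph_axioms by (auto simp: complete_digraph_def)
qed

section \<open>Irredundant sets\<close>

lemma (in graph) irredundant_independent:
  assumes "independent_set G S"
  shows "irredundant G S"
proof -
  have "v \<in> private_nbh G v S" if "v \<in> S" for v
    using assms that unfolding mem_private_nbh_iff closed_nbh_def independent_set_def by blast
  then show ?thesis
    using assms unfolding irredundant_def independent_set_def by blast
qed

lemma (in graph) irredundant_singleton: "v \<in> verts G \<Longrightarrow> irredundant G {v}"
  by (rule irredundant_independent) (simp add: independent_set_def)

lemma (in graph) maximal_irredundant_nonempty:
  assumes "maximal_irredundant G R" "verts G \<noteq> {}"
  shows "R \<noteq> {}"
  using assms irredundant_singleton by (auto simp: maximal_irredundant_def)

lemma (in graph) maximal_irredundant_dominating:
  assumes "irredundant G S" "dominating_set G S"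
  shows "maximal_irredundant G S"
  unfolding maximal_irredundant_def
proof (intro conjI ballI)
  fix w assume "w \<in> verts G - S"
  then have "private_nbh G w (S \<union> {w}) = {}"
    using closed_nbh_subset_verts[of w] assms(2)
    by (auto simp: private_nbh_def dominating_set_def)
  then show "\<not> irredundant G (S \<union> {w})" by (auto simp: irredundant_def)
qed fact

lemma (in graph) maximal_irredundant_independent_iff:
  assumes "independent_set G S"
  shows "maximal_irredundant G S \<longleftrightarrow> dominating_set G S"
proof
  assume max: "maximal_irredundant G S"
  have "w \<in> closed_nbh_set G S" if "w \<in> verts G" for w
  proof (rule ccontr)
    assume undominated: "w \<notin> closed_nbh_set G S"
    then have "w \<notin> S" "w \<notin> nbh G v" if "v \<in> S" for v
      using that by (auto simp: closed_nbh_set_def closed_nbh_def)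
    then have "independent_set G (S \<union> {w})"
      using assms \<open>w \<in> verts G\<close> nbh_commute[of _ w] by (auto simp: independent_set_def)
    moreover have "w \<notin> S"
      using undominated by (auto simp: closed_nbh_set_def closed_nbh_def)
    ultimately show False
      using max that irredundant_independent by (auto simp: maximal_irredundant_def)
  qed
  moreover have "closed_nbh_set G S \<subseteq> verts G"
    using assms closed_nbh_subset_verts by (auto simp: independent_set_def closed_nbh_set_def)
  ultimately show "dominating_set G S"
    using assms by (auto simp: dominating_set_def independent_set_def)
qed (use assms irredundant_independent maximal_irredundant_dominating in blast)

lemma (in graph) maximal_irredundant_singleton_iff:
  "maximal_irredundant G {v} \<longleftrightarrow> v \<in> verts G \<and> nbh G v = verts G - {v}"
proof -
  have "maximal_irredundant G {v} \<longleftrightarrow> insert v (nbh G v) = verts G" if "v \<in> verts G"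
    using that maximal_irredundant_independent_iff[of "{v}"]
    by (simp add: independent_set_def dominating_set_def closed_nbh_set_def closed_nbh_def)
  moreover have "insert v (nbh G v) = verts G \<longleftrightarrow> nbh G v = verts G - {v}" if "v \<in> verts G"
    using that not_mem_nbh_self[of v] by blast
  ultimately show ?thesis
    using maximal_irredundant_subset_verts[of G "{v}"] by auto
qed

lemma (in graph) private_nbh_verts:
  assumes "v \<in> verts G" "nbh G v \<noteq> {}"
  shows "private_nbh G v (verts G) = {}"
proof -
  have "\<exists>w\<in>verts G - {v}. u \<in> closed_nbh G w" if "u \<in> closed_nbh G v" for u
  proof (cases "u = v")
    case True
    then show ?thesis
      using assms nbh_subset_verts nbh_commute not_mem_nbh_self unfolding closed_nbh_def by blast
  next
    case False
    then show ?thesis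
      using that assms(1) closed_nbh_subset_verts unfolding closed_nbh_def by blast
  qed
  then show ?thesis unfolding private_nbh_def closed_nbh_set_def by blast
qed

lemma (in graph) star_iff_maximal_irredundant_singleton:
  "complete_bipartite_digraph 1 (card (verts G) - 1) G \<longleftrightarrow>
    (\<exists>V1 V2. bipartition G V1 V2) \<and> (\<exists>v. maximal_irredundant G {v})" (is "?L \<longleftrightarrow> ?R")
proof
  assume ?L
  then obtain U V where bipartite: "verts G = U \<union> V" "U \<inter> V = {}" "card U = 1"
    "arcs_ends G = U \<times> V \<union> V \<times> U" by (auto simp: complete_bipartite_digraph_def)
  then have "bipartition G U V" by (simp add: bipartition_def)
  moreover obtain v where "U = {v}" using bipartite(3) by (rule card_1_singletonE)
  then have "nbh G v = verts G - {v}" "v \<in> verts G" using bipartite by (auto simp: nbh_def)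
  ultimately show ?R using maximal_irredundant_singleton_iff by blast
next
  assume ?R
  then obtain V1 V2 v where "bipartition G V1 V2" and dominating: "v \<in> verts G" "nbh G v = verts G - {v}"
    using maximal_irredundant_singleton_iff by blast
  then obtain V1 V2 where bipartite: "bipartition G V1 V2" "v \<in> V1"
    using bipartition_swap by (metis UnE bipartition_def)
  have "w = v" if "w \<in> V1" for w
    using that bipartite dominating unfolding bipartition_def nbh_def by blast
  then have "arcs_ends G \<subseteq> {v} \<times> (verts G - {v}) \<union> (verts G - {v}) \<times> {v}"
    using bipartite unfolding bipartition_def by blast
  moreover have "{v} \<times> (verts G - {v}) \<union> (verts G - {v}) \<times> {v} \<subseteq> arcs_ends G"
    using dominating(2) nbh_commute unfolding nbh_def by blast
  ultimately have "arcs_ends G = {v} \<times> (verts G - {v}) \<union> (verts G - {v}) \<times> {v}" ..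
  then show ?L
    unfolding complete_bipartite_digraph_def using dominating(1) graph_axioms
    by (intro conjI exI[of _ "{v}"] exI[of _ "verts G - {v}"]) (simp_all add: insert_absorb)
qed

section \<open>The irredundance chromatic number\<close>

lemma (in graph) irredundance_chromatic_number_attained:
  obtains c where "irredundance_coloring G c" "card (c ` verts G) = \<chi>\<^sub>i G"
proof -
  have "\<exists>k c. irredundance_coloring G c \<and> card (c ` verts G) = k"
    using irredundance_coloring_exists by blast
  from LeastI_ex[OF this] show thesis
    using that unfolding irredundance_chromatic_number_def by blast
qed

lemma (in graph) irredundance_chromatic_number_le_iff:
  "\<chi>\<^sub>i G \<le> k \<longleftrightarrow> (\<exists>c. irredundance_coloring G c \<and> c ` verts G \<subseteq> {..<k})"
proof
  assume "\<chi>\<^sub>i G \<le> k"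
  obtain c where coloring: "irredundance_coloring G c" "card (c ` verts G) = \<chi>\<^sub>i G"
    by (rule irredundance_chromatic_number_attained)
  then obtain f where recoloring: "f ` c ` verts G \<subseteq> {..<k}" "inj_on f (c ` verts G)"
    using \<open>\<chi>\<^sub>i G \<le> k\<close> card_le_inj[of "c ` verts G" "{..<k}"] by auto
  obtain R where maximal: "maximal_irredundant G R" "inj_on c R"
    using coloring(1) by (auto simp: irredundance_coloring_def)
  then have "inj_on (f \<circ> c) R"
    using recoloring(2) maximal_irredundant_subset_verts[OF maximal(1)]
    by (intro comp_inj_on inj_on_subset[OF recoloring(2)] image_mono)
  moreover have "proper_coloring G (f \<circ> c)"
    using coloring(1) recoloring(2) adj_in_verts
    unfolding proper_coloring_def irredundance_coloring_def by (simp add: inj_on_eq_iff)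
  ultimately have "irredundance_coloring G (f \<circ> c)"
    using maximal(1) by (auto simp: irredundance_coloring_def)
  then show "\<exists>c. irredundance_coloring G c \<and> c ` verts G \<subseteq> {..<k}"
    using recoloring(1) by (metis image_comp)
next
  assume "\<exists>c. irredundance_coloring G c \<and> c ` verts G \<subseteq> {..<k}"
  then obtain c where coloring: "irredundance_coloring G c" "c ` verts G \<subseteq> {..<k}" by blast
  then have "\<chi>\<^sub>i G \<le> card (c ` verts G)"
    by (intro irredundance_chromatic_number_le)
  also have "\<dots> \<le> k" using card_mono[OF _ coloring(2)] by simp
  finally show "\<chi>\<^sub>i G \<le> k" .
qed

lemma (in graph) irredundance_chromatic_number_le_order: "\<chi>\<^sub>i G \<le> card (verts G)"
proof -
  obtain c where "irredundance_coloring G c" "card (c ` verts G) = \<chi>\<^sub>i G"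
    by (rule irredundance_chromatic_number_attained)
  then show ?thesis using card_image_le[OF finite_verts, of c] by simp
qed

lemma (in graph) irredundance_chromatic_number_ge_2:
  assumes "u \<rightarrow>\<^bsub>G\<^esub> v"
  shows "2 \<le> \<chi>\<^sub>i G"
proof (rule ccontr)
  assume "\<not> 2 \<le> \<chi>\<^sub>i G"
  then have "\<chi>\<^sub>i G \<le> 1" by simp
  then obtain c where coloring: "irredundance_coloring G c" "c ` verts G \<subseteq> {..<1}"
    unfolding irredundance_chromatic_number_le_iff by blast
  then have "c u = c v"
    using adj_in_verts[OF assms] by (auto simp: image_subset_iff)
  then show False
    using coloring(1) assms by (auto simp: irredundance_coloring_def proper_coloring_def)
qed

lemma (in graph) proper_coloring_identifying_nonadjacent:
  assumes "u \<in> verts G" and nonadjacent: "v \<in> verts G - {u} - nbh G u"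
  obtains c :: "'a \<Rightarrow> nat" where "proper_coloring G c" "c u = c v"
    "\<And>x y. x \<in> verts G \<Longrightarrow> y \<in> verts G \<Longrightarrow> c x = c y \<Longrightarrow> x = y \<or> {x, y} = {u, v}"
proof -
  obtain f :: "'a \<Rightarrow> nat" where inj: "inj_on f (verts G)"
    using finite_imp_inj_to_nat_seg[OF finite_verts] by blast
  define c where "c = f(u := f v)"
  have same_colour: "x = y \<or> {x, y} = {u, v}"
    if "x \<in> verts G" "y \<in> verts G" "c x = c y" for x y
    using that inj nonadjacent by (auto simp: c_def inj_on_eq_iff split: if_splits)
  have "proper_coloring G c"
    unfolding proper_coloring_def
  proof (intro allI impI notI)
    fix x y assume edge: "x \<rightarrow>\<^bsub>G\<^esub> y" and "c x = c y"
    then have "y \<in> nbh G x" "x = y \<or> {x, y} = {u, v}"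
      using same_colour adj_in_verts[OF edge] by (simp_all add: mem_nbh)
    then show False
      using nonadjacent nbh_commute[of u v] by (auto simp: doubleton_eq_iff)
  qed
  moreover have "c u = c v" by (simp add: c_def)
  ultimately show thesis using same_colour by (rule that)
qed

lemma (in graph) irredundance_chromatic_number_less_order:
  assumes max: "maximal_irredundant G R"
    and outside: "u \<in> verts G - R" and nonadjacent: "v \<in> verts G - {u} - nbh G u"
  shows "\<chi>\<^sub>i G < card (verts G)"
proof -
  have "u \<in> verts G" using outside by blast
  then obtain c :: "'a \<Rightarrow> nat" where proper: "proper_coloring G c" and "c u = c v"
    and same_colour:
      "\<And>x y. x \<in> verts G \<Longrightarrow> y \<in> verts G \<Longrightarrow> c x = c y \<Longrightarrow> x = y \<or> {x, y} = {u, v}"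
    using proper_coloring_identifying_nonadjacent[OF _ nonadjacent] by metis
  have "inj_on c R"
    using same_colour outside maximal_irredundant_subset_verts[OF max]
    by (auto simp: inj_on_def doubleton_eq_iff)
  then have "\<chi>\<^sub>i G \<le> card (c ` verts G)"
    using max proper
    by (intro irredundance_chromatic_number_le) (auto simp: irredundance_coloring_def)
  moreover have "\<not> inj_on c (verts G)"
    using outside nonadjacent \<open>c u = c v\<close> by (auto dest: inj_onD[of _ _ u v])
  then have "card (c ` verts G) \<noteq> card (verts G)"
    by (simp add: inj_on_iff_eq_card)
  ultimately show ?thesis
    using card_image_le[OF finite_verts, of c] by simp
qed

lemma (in graph) irredundance_chromatic_number_eq_order_iff:
  assumes "verts G \<noteq> {}" "\<forall>v\<in>verts G. nbh G v \<noteq> {}"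
  shows "\<chi>\<^sub>i G = card (verts G) \<longleftrightarrow> complete_digraph (card (verts G)) G"
proof
  assume max_colours: "\<chi>\<^sub>i G = card (verts G)"
  have dominating: "nbh G u = verts G - {u}"
    if "maximal_irredundant G R" "u \<in> verts G - R" for R u
  proof
    show "nbh G u \<subseteq> verts G - {u}" using nbh_subset_verts by auto
    show "verts G - {u} \<subseteq> nbh G u"
      using irredundance_chromatic_number_less_order[OF that] max_colours by auto
  qed
  obtain R where maximal: "maximal_irredundant G R"
    using irredundance_coloring_exists by (auto simp: irredundance_coloring_def)
  then have "R \<noteq> verts G"
    using assms private_nbh_verts by (auto simp: maximal_irredundant_def irredundant_def)
  then obtain w where outside: "w \<in> verts G - R"
    using maximal_irredundant_subset_verts[OF maximal] by blast
  then have "maximal_irredundant G {w}"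
    using dominating[OF maximal] by (simp add: maximal_irredundant_singleton_iff)
  then have "nbh G u = verts G - {u}" if "u \<in> verts G" for u
    using dominating[OF maximal outside] dominating[of "{w}" u] that by blast
  then show "complete_digraph (card (verts G)) G"
    by (simp add: complete_digraph_iff)
next
  assume complete: "complete_digraph (card (verts G)) G"
  obtain c where coloring: "irredundance_coloring G c" "card (c ` verts G) = \<chi>\<^sub>i G"
    by (rule irredundance_chromatic_number_attained)
  then have "inj_on c (verts G)"
    using complete
    by (auto simp: inj_on_def irredundance_coloring_def proper_coloring_def complete_digraph_def)
  then show "\<chi>\<^sub>i G = card (verts G)"
    using coloring(2) by (simp add: card_image)
qed

lemma (in graph) bipartition_of_proper_2_coloring:
  assumes "proper_coloring G c" "c ` verts G \<subseteq> {..<2}"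
  shows "bipartition G {v \<in> verts G. c v = 0} {v \<in> verts G. c v = 1}" (is "bipartition G ?V ?W")
proof -
  have two_colours: "c v = 0 \<or> c v = 1" if "v \<in> verts G" for v
    using that assms(2) by (auto simp: image_subset_iff less_2_cases_iff)
  have "(u, v) \<in> ?V \<times> ?W \<union> ?W \<times> ?V" if "u \<rightarrow>\<^bsub>G\<^esub> v" for u v
    using adj_in_verts[OF that] two_colours[of u] two_colours[of v] assms(1) that
    unfolding proper_coloring_def by force
  then have "arcs_ends G \<subseteq> ?V \<times> ?W \<union> ?W \<times> ?V" by (rule subrelI)
  moreover have "verts G = ?V \<union> ?W" "?V \<inter> ?W = {}" using two_colours by auto
  ultimately show ?thesis unfolding bipartition_def by blast
qed

text \<open>Injectivity of \<open>\<lambda>v. v \<in> V1\<close> on \<open>R\<close> means that \<open>R\<close> has at most one vertex on each side.\<close>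

lemma (in graph) irredundance_chromatic_number_le_2_iff:
  "\<chi>\<^sub>i G \<le> 2 \<longleftrightarrow>
    (\<exists>V1 V2 R. bipartition G V1 V2 \<and> maximal_irredundant G R \<and> inj_on (\<lambda>v. v \<in> V1) R)"
proof
  assume "\<chi>\<^sub>i G \<le> 2"
  then obtain c where "irredundance_coloring G c" and two_colours: "c ` verts G \<subseteq> {..<2}"
    unfolding irredundance_chromatic_number_le_iff by blast
  then obtain R where "proper_coloring G c" and maximal: "maximal_irredundant G R"
    and inj: "inj_on c R"
    by (auto simp: irredundance_coloring_def)
  then have "bipartition G {v \<in> verts G. c v = 0} {v \<in> verts G. c v = 1}"
    using two_colours bipartition_of_proper_2_coloring by blast
  moreover have "inj_on (\<lambda>v. v \<in> {v \<in> verts G. c v = 0}) R"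
  proof (rule inj_onI)
    fix u v assume in_R: "u \<in> R" "v \<in> R"
      and same_side: "(u \<in> {v \<in> verts G. c v = 0}) = (v \<in> {v \<in> verts G. c v = 0})"
    then have in_verts: "u \<in> verts G" "v \<in> verts G"
      using maximal_irredundant_subset_verts[OF maximal] by blast+
    then have "c u < 2" "c v < 2" using two_colours by auto
    then have "c u = c v" using same_side in_verts by auto
    then show "u = v" using in_R inj by (simp add: inj_on_eq_iff)
  qed
  ultimately show "\<exists>V1 V2 R. bipartition G V1 V2 \<and> maximal_irredundant G R \<and> inj_on (\<lambda>v. v \<in> V1) R"
    using maximal by blast
next
  assume "\<exists>V1 V2 R. bipartition G V1 V2 \<and> maximal_irredundant G R \<and> inj_on (\<lambda>v. v \<in> V1) R"
  then obtain V1 V2 R where "bipartition G V1 V2" "maximal_irredundant G R" "inj_on (\<lambda>v. v \<in> V1) R"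
    by blast
  then have "irredundance_coloring G (\<lambda>v. of_bool (v \<in> V1))"
    by (auto simp: irredundance_coloring_def proper_coloring_def bipartition_def inj_on_def)
  moreover have "(\<lambda>v. of_bool (v \<in> V1)) ` verts G \<subseteq> {..<2 :: nat}" by auto
  ultimately show "\<chi>\<^sub>i G \<le> 2"
    unfolding irredundance_chromatic_number_le_iff by blast
qed

lemma (in graph) irredundance_chromatic_number_star_le_2:
  assumes "complete_bipartite_digraph 1 (card (verts G) - 1) G"
  shows "\<chi>\<^sub>i G \<le> 2"
proof -
  obtain V1 V2 v where "bipartition G V1 V2" "maximal_irredundant G {v}"
    using assms star_iff_maximal_irredundant_singleton by blast
  moreover have "inj_on (\<lambda>v. v \<in> V1) {v}" by simp
  ultimately show ?thesis unfolding irredundance_chromatic_number_le_2_iff by blast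
qed

section \<open>Maximal irredundant pairs in bipartite graphs\<close>

locale bipartite_graph = graph G for G :: "('a, 'b) pre_digraph" +
  fixes V1 V2 :: "'a set"
  assumes bipartition: "bipartition G V1 V2"

lemma (in bipartite_graph) verts_eq: "verts G = V1 \<union> V2" and disjoint: "V1 \<inter> V2 = {}"
  using bipartition by (auto simp: bipartition_def)

lemma (in bipartite_graph) nbh_subset: "v \<in> V1 \<Longrightarrow> nbh G v \<subseteq> V2" "v \<in> V2 \<Longrightarrow> nbh G v \<subseteq> V1"
  using bipartition unfolding bipartition_def nbh_def by blast+

lemma (in bipartite_graph) ex_maximal_irredundant_crossing_pair_iff:
  assumes "verts G \<noteq> {}" "\<not> (\<exists>v. maximal_irredundant G {v})"
  shows "(\<exists>R. maximal_irredundant G R \<and> inj_on (\<lambda>v. v \<in> V1) R) \<longleftrightarrow>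
    (\<exists>v1\<in>V1. \<exists>v2\<in>V2. maximal_irredundant G {v1, v2})"
proof
  assume "\<exists>R. maximal_irredundant G R \<and> inj_on (\<lambda>v. v \<in> V1) R"
  then obtain R where maximal: "maximal_irredundant G R"
    and inj: "inj_on (\<lambda>v. v \<in> V1) R" by blast
  have at_most_one: "u = v" if "u \<in> R" "v \<in> R" "u \<in> V1 \<longleftrightarrow> v \<in> V1" for u v
    using inj that by (auto dest: inj_onD)
  obtain u where u_in: "u \<in> R"
    using maximal_irredundant_nonempty[OF maximal assms(1)] by blast
  moreover have "R \<noteq> {u}"
    using maximal assms(2) by auto
  ultimately obtain v where v_in: "v \<in> R" "v \<noteq> u" by blast
  have "R = {u, v}"
    using at_most_one u_in v_in by blast
  moreover have "u \<in> V1 \<and> v \<in> V2 \<or> v \<in> V1 \<and> u \<in> V2"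
    using at_most_one u_in v_in maximal_irredundant_subset_verts[OF maximal] verts_eq by blast
  ultimately show "\<exists>v1\<in>V1. \<exists>v2\<in>V2. maximal_irredundant G {v1, v2}"
    using maximal by (metis insert_commute)
next
  assume "\<exists>v1\<in>V1. \<exists>v2\<in>V2. maximal_irredundant G {v1, v2}"
  then obtain v1 v2 where "v1 \<in> V1" "v2 \<in> V2" "maximal_irredundant G {v1, v2}" by blast
  moreover from this have "inj_on (\<lambda>v. v \<in> V1) {v1, v2}" using disjoint by auto
  ultimately show "\<exists>R. maximal_irredundant G R \<and> inj_on (\<lambda>v. v \<in> V1) R" by blast
qed

lemma (in bipartite_graph) maximal_irredundant_nonadjacent_pair_iff:
  assumes pair: "v1 \<in> V1" "v2 \<in> V2" "\<not> v1 \<rightarrow>\<^bsub>G\<^esub> v2"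
  shows "maximal_irredundant G {v1, v2} \<longleftrightarrow> nbh G v1 = V2 - {v2} \<and> nbh G v2 = V1 - {v1}"
proof -
  have not_adjacent: "v2 \<notin> nbh G v1" "v1 \<notin> nbh G v2"
    using pair(3) nbh_commute by (simp_all add: mem_nbh)
  then have "independent_set G {v1, v2}"
    using pair verts_eq by (auto simp: independent_set_def)
  then have "maximal_irredundant G {v1, v2} \<longleftrightarrow>
      insert v1 (nbh G v1) \<union> insert v2 (nbh G v2) = V1 \<union> V2" (is "_ \<longleftrightarrow> ?N = _")
    using pair by (simp add: maximal_irredundant_independent_iff dominating_set_def
        closed_nbh_set_def closed_nbh_def verts_eq)
  also have "\<dots> \<longleftrightarrow> ?N \<inter> V2 = V2 \<and> ?N \<inter> V1 = V1"
    using pair nbh_subset(1)[OF pair(1)] nbh_subset(2)[OF pair(2)] by auto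
  also have "\<dots> \<longleftrightarrow> insert v2 (nbh G v1) = V2 \<and> insert v1 (nbh G v2) = V1"
  proof -
    have "?N \<inter> V2 = insert v2 (nbh G v1)" "?N \<inter> V1 = insert v1 (nbh G v2)"
      using pair disjoint nbh_subset(1)[OF pair(1)] nbh_subset(2)[OF pair(2)] by auto
    then show ?thesis by simp
  qed
  also have "\<dots> \<longleftrightarrow> nbh G v1 = V2 - {v2} \<and> nbh G v2 = V1 - {v1}"
    using not_adjacent pair by auto
  finally show ?thesis .
qed

lemma (in bipartite_graph) property_Im2_iff:
  "property_Im2 G V1 V2 \<longleftrightarrow>
    (\<exists>v1\<in>V1. \<exists>v2\<in>V2. \<not> v1 \<rightarrow>\<^bsub>G\<^esub> v2 \<and> maximal_irredundant G {v1, v2})"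
  unfolding property_Im2_def using maximal_irredundant_nonadjacent_pair_iff by blast

sublocale bipartite_graph \<subseteq> flip: bipartite_graph G V2 V1
  by unfold_locales (rule bipartition_swap[OF bipartition])

locale bipartite_edge = bipartite_graph +
  fixes v1 v2 :: 'a
  assumes v1_in: "v1 \<in> V1" and v2_in: "v2 \<in> V2" and adjacent: "v1 \<rightarrow>\<^bsub>G\<^esub> v2"

sublocale bipartite_edge \<subseteq> flip: bipartite_edge G V2 V1 v2 v1
  by unfold_locales (use v1_in v2_in adjacent graph_symmetric in auto)

text \<open>The index is that of the side containing the set, so \<open>flip\<close> exchanges \<open>near1\<close> with
  \<open>near2\<close> and \<open>far1\<close> with \<open>far2\<close>.\<close>

abbreviation (in bipartite_edge) near1 :: "'a set" where "near1 \<equiv> nbh G v2 - {v1}"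
abbreviation (in bipartite_edge) near2 :: "'a set" where "near2 \<equiv> nbh G v1 - {v2}"
abbreviation (in bipartite_edge) far1 :: "'a set" where "far1 \<equiv> V1 - nbh G v2"
abbreviation (in bipartite_edge) far2 :: "'a set" where "far2 \<equiv> V2 - nbh G v1"

definition (in bipartite_edge) saturated :: bool where
  "saturated \<longleftrightarrow> near1 \<noteq> {} \<and> near2 \<noteq> {} \<and>
     complete_to G far1 near2 \<and> complete_to G far2 near1 \<and>
     (complete_to G near1 near2 \<or>
       (far1 = {} \<or> card near2 = 1) \<and> (far2 = {} \<or> card near1 = 1))"

lemma (in bipartite_edge) v2_in_nbh: "v2 \<in> nbh G v1"
  using adjacent by (simp add: mem_nbh)

lemma (in bipartite_edge) near2_subset: "near2 \<subseteq> V2"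
  using nbh_subset(1)[OF v1_in] by blast

lemma (in bipartite_edge) irredundant_edge_iff:
  "irredundant G {v1, v2} \<longleftrightarrow> near1 \<noteq> {} \<and> near2 \<noteq> {}"
proof -
  have "v1 \<noteq> v2" using v1_in v2_in disjoint by blast
  then have "private_nbh G v1 {v1, v2} = near2" "private_nbh G v2 {v1, v2} = near1"
    using v2_in_nbh flip.v2_in_nbh nbh_subset(1)[OF v1_in] nbh_subset(2)[OF v2_in] disjoint
    by (auto simp: private_nbh_def closed_nbh_def closed_nbh_set_def insert_Diff_if)
  then show ?thesis using v1_in v2_in verts_eq by (auto simp: irredundant_def)
qed

lemma (in bipartite_edge) irredundant_edge_insert_iff:
  assumes w_in: "w \<in> V2 - {v2}"
  shows "irredundant G {v1, v2, w} \<longleftrightarrow>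
    \<not> near2 \<subseteq> {w} \<and> \<not> near1 \<subseteq> nbh G w \<and> (w \<in> nbh G v1 \<longrightarrow> \<not> nbh G w \<subseteq> nbh G v2)"
proof -
  have distinct: "v1 \<noteq> v2" "w \<noteq> v1" "w \<noteq> v2" using w_in v1_in v2_in disjoint by auto
  note nbhs = v2_in_nbh flip.v2_in_nbh nbh_subset(1)[OF v1_in] nbh_subset(2)[OF v2_in]
    nbh_subset(2)[of w]
  have "private_nbh G v1 {v1, v2, w} = near2 - {w}"
    "private_nbh G v2 {v1, v2, w} = near1 - nbh G w"
    "private_nbh G w {v1, v2, w} = nbh G w - nbh G v2 \<union> ({w} - nbh G v1)"
    using w_in distinct nbhs disjoint
    by (auto simp: private_nbh_def closed_nbh_def closed_nbh_set_def insert_Diff_if)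
  moreover have "{v1, v2, w} \<subseteq> verts G" using w_in v1_in v2_in verts_eq by blast
  ultimately show ?thesis unfolding irredundant_def by auto
qed

lemma (in bipartite_edge) nbh_near2_bounds:
  assumes "complete_to G far1 near2" "x \<in> near2"
  shows "insert v1 far1 \<subseteq> nbh G x" "nbh G x \<subseteq> V1"
proof -
  have "far1 \<subseteq> nbh G x"
    using assms unfolding complete_to_commute[of far1] by (simp add: complete_to_def)
  moreover have "v1 \<in> nbh G x" using assms(2) nbh_commute[of v1] by blast
  ultimately show "insert v1 far1 \<subseteq> nbh G x" by blast
  show "nbh G x \<subseteq> V1" using assms(2) near2_subset nbh_subset(2)[of x] by blast
qed

lemma (in bipartite_edge) nbh_near2_subset_iff:
  assumes "complete_to G far1 near2" "x \<in> near2"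
  shows "nbh G x \<subseteq> nbh G v2 \<longleftrightarrow> far1 = {}"
  using nbh_near2_bounds[OF assms] by blast

lemma (in bipartite_edge) nbh_near2_eq_V1_iff:
  assumes "complete_to G far1 near2" "x \<in> near2"
  shows "nbh G x = V1 \<longleftrightarrow> near1 \<subseteq> nbh G x"
  using nbh_near2_bounds[OF assms] flip.near2_subset by blast

lemma (in bipartite_edge) irredundant_insert_far2_iff:
  assumes "near2 \<noteq> {}"
  shows "(\<forall>w\<in>far2. \<not> irredundant G {v1, v2, w}) \<longleftrightarrow> complete_to G far2 near1"
proof -
  have "irredundant G {v1, v2, w} \<longleftrightarrow> \<not> near1 \<subseteq> nbh G w" if "w \<in> far2" for w
  proof -
    have "w \<in> V2 - {v2}" "w \<notin> nbh G v1" "\<not> near2 \<subseteq> {w}"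
      using that assms v2_in_nbh by auto
    then show ?thesis using irredundant_edge_insert_iff[of w] by blast
  qed
  then show ?thesis by (simp add: complete_to_def)
qed

lemma (in bipartite_edge) irredundant_insert_near2_iff:
  assumes "near2 \<noteq> {}" "complete_to G far1 near2"
  shows "(\<forall>w\<in>near2. \<not> irredundant G {v1, v2, w}) \<longleftrightarrow>
    far1 = {} \<or> card near2 = 1 \<or> complete_to G near2 near1"
proof -
  have "near2 \<subseteq> {w} \<longleftrightarrow> card near2 = 1" if "w \<in> near2" for w
    using that card_eq_1_iff_subset_singleton[of w near2] by blast
  moreover have "w \<in> V2 - {v2}" if "w \<in> near2" for w
    using that near2_subset by blast
  ultimately have "irredundant G {v1, v2, w} \<longleftrightarrow>
      \<not> (far1 = {} \<or> card near2 = 1 \<or> near1 \<subseteq> nbh G w)" if "w \<in> near2" for w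
    using that irredundant_edge_insert_iff[of w] nbh_near2_subset_iff[OF assms(2), of w] by blast
  then show ?thesis
    unfolding complete_to_def using assms(1) by auto
qed

lemma (in bipartite_edge) Im1_third_condition_iff:
  assumes "near2 \<noteq> {}" "complete_to G far1 near2"
  shows "(3 \<le> deg G v1 \<longrightarrow>
      (\<forall>x\<in>nbh G v1. deg G x = 1 \<or> nbh G x \<subseteq> nbh G v2 \<or> nbh G x = V1)) \<longleftrightarrow>
    far1 = {} \<or> card near2 = 1 \<or> complete_to G near2 near1"
proof -
  have "(deg G x = 1 \<or> nbh G x \<subseteq> nbh G v2 \<or> nbh G x = V1) \<longleftrightarrow> far1 = {} \<or> near1 \<subseteq> nbh G x"
    if x_in: "x \<in> near2" for x
  proof -
    have "nbh G x \<subseteq> nbh G v2" if "deg G x = 1"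
    proof -
      have "v1 \<in> nbh G x" using x_in nbh_commute[of v1] by blast
      then have "nbh G x = {v1}" using that by (auto simp: deg_def card_1_singleton_iff)
      then show ?thesis using flip.v2_in_nbh by simp
    qed
    then show ?thesis
      using nbh_near2_subset_iff[OF assms(2) x_in] nbh_near2_eq_V1_iff[OF assms(2) x_in] by blast
  qed
  then have "(\<forall>x\<in>nbh G v1. deg G x = 1 \<or> nbh G x \<subseteq> nbh G v2 \<or> nbh G x = V1) \<longleftrightarrow>
      far1 = {} \<or> complete_to G near2 near1"
    using assms(1) unfolding complete_to_def by blast
  moreover have "3 \<le> deg G v1 \<longleftrightarrow> card near2 \<noteq> 1"
  proof -
    have "card near2 \<noteq> 0" using assms(1) by simp
    then show ?thesis using deg_eq_Suc_card[OF v2_in_nbh] by linarith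
  qed
  ultimately show ?thesis by blast
qed

lemma (in bipartite_edge) maximal_irredundant_edge_iff:
  "maximal_irredundant G {v1, v2} \<longleftrightarrow> saturated"
proof -
  have "verts G - {v1, v2} = far1 \<union> near1 \<union> (far2 \<union> near2)"
    using v1_in v2_in v2_in_nbh flip.v2_in_nbh near2_subset flip.near2_subset disjoint verts_eq
    by blast
  then have "maximal_irredundant G {v1, v2} \<longleftrightarrow> irredundant G {v1, v2} \<and>
      (\<forall>w\<in>far2. \<not> irredundant G {v1, v2, w}) \<and> (\<forall>w\<in>far1. \<not> irredundant G {v2, v1, w}) \<and>
      (\<forall>w\<in>near2. \<not> irredundant G {v1, v2, w}) \<and> (\<forall>w\<in>near1. \<not> irredundant G {v2, v1, w})"
    by (simp add: maximal_irredundant_def insert_commute ball_Un) blast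
  also have "\<dots> \<longleftrightarrow> saturated"
    unfolding saturated_def irredundant_edge_iff
    using irredundant_insert_far2_iff flip.irredundant_insert_far2_iff
      irredundant_insert_near2_iff flip.irredundant_insert_near2_iff
      complete_to_commute[of near1 near2] by argo
  finally show ?thesis .
qed

lemma (in bipartite_edge) Im1_conditions_iff:
  "2 \<le> deg G v1 \<and> 2 \<le> deg G v2 \<and>
    (\<forall>y\<in>far2. \<forall>x\<in>near1. y \<rightarrow>\<^bsub>G\<^esub> x) \<and> (\<forall>y\<in>far1. \<forall>x\<in>near2. y \<rightarrow>\<^bsub>G\<^esub> x) \<and>
    (3 \<le> deg G v1 \<longrightarrow>
      (\<forall>x\<in>nbh G v1. deg G x = 1 \<or> nbh G x \<subseteq> nbh G v2 \<or> nbh G x = V1)) \<and>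
    (3 \<le> deg G v2 \<longrightarrow>
      (\<forall>x\<in>nbh G v2. deg G x = 1 \<or> nbh G x \<subseteq> nbh G v1 \<or> nbh G x = V2)) \<longleftrightarrow>
    maximal_irredundant G {v1, v2}"
proof -
  have two_le_deg: "2 \<le> deg G v1 \<longleftrightarrow> near2 \<noteq> {}" "2 \<le> deg G v2 \<longleftrightarrow> near1 \<noteq> {}"
    unfolding deg_eq_Suc_card[OF v2_in_nbh] deg_eq_Suc_card[OF flip.v2_in_nbh]
    by (auto simp: Suc_le_eq card_gt_0_iff)
  have all_adjacent: "(\<forall>y\<in>X. \<forall>x\<in>Y. y \<rightarrow>\<^bsub>G\<^esub> x) \<longleftrightarrow> complete_to G X Y" for X Y
    by (simp add: complete_to_def subset_eq mem_nbh)
  show ?thesis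
    unfolding maximal_irredundant_edge_iff saturated_def two_le_deg all_adjacent
    using Im1_third_condition_iff flip.Im1_third_condition_iff complete_to_commute[of near1 near2]
    by argo
qed

lemma (in bipartite_graph) property_Im1_iff:
  "property_Im1 G V1 V2 \<longleftrightarrow>
    (\<exists>v1\<in>V1. \<exists>v2\<in>V2. v1 \<rightarrow>\<^bsub>G\<^esub> v2 \<and> maximal_irredundant G {v1, v2})"
proof -
  have "bipartite_edge G V1 V2 v1 v2" if "v1 \<in> V1" "v2 \<in> V2" "v1 \<rightarrow>\<^bsub>G\<^esub> v2" for v1 v2
    using that by unfold_locales
  then show ?thesis
    unfolding property_Im1_def
    by (intro bex_cong refl conj_cong bipartite_edge.Im1_conditions_iff)
qed

lemma (in bipartite_edge) saturated_imp_property_Im1: "saturated \<Longrightarrow> property_Im1 G V1 V2"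
  using v1_in v2_in adjacent maximal_irredundant_edge_iff property_Im1_iff by blast

section \<open>The families\<close>

lemma (in bipartite_graph) arcs_ends_eq_symcl: "arcs_ends G = symcl (SIGMA v:V1. nbh G v)"
proof -
  have "(u, v) \<in> arcs_ends G \<longleftrightarrow> (u, v) \<in> symcl (SIGMA v:V1. nbh G v)" for u v
    using bipartition nbh_commute[of u v] by (auto simp: bipartition_def mem_symcl_iff mem_nbh)
  then show ?thesis by (simp add: set_eq_iff)
qed

lemma (in bipartite_graph) family_F2I:
  assumes "v1 \<in> V1" "v2 \<in> V2" "nbh G v1 = V2" "nbh G v2 = V1"
  shows "G \<in> family_F2"
  unfolding family_F2_def using assms bipartition graph_axioms by blast

lemma (in graph) family_F3_iff:
  "G \<in> family_F3 \<longleftrightarrow> (\<exists>V1 V2. bipartition G V1 V2 \<and> property_Im2 G V1 V2)"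
  using graph_axioms by (simp add: family_F3_def property_Im2_def)

lemma (in bipartite_edge) family_F1I:
  assumes "near1 = {x}" "far1 = {}" "near2 \<noteq> {}" "far2 \<noteq> {}" "complete_to G far2 near1"
  shows "G \<in> family_F1"
proof -
  define A where "A = near2"
  define B where "B = far2"
  define S where "S = nbh G x \<inter> A"
  have V1_eq: "V1 = {v1, x}" "v1 \<noteq> x"
    using assms(1,2) flip.near2_subset v1_in by auto
  have V2_eq: "V2 = {v2} \<union> A \<union> B"
    using near2_subset v2_in unfolding A_def B_def by blast
  have nbh_v1: "nbh G v1 = insert v2 A"
    using v2_in_nbh unfolding A_def by blast
  have "B \<subseteq> nbh G x"
    using assms(1,5) unfolding complete_to_commute[of far2] B_def by (simp add: complete_to_def)
  moreover have "v2 \<in> nbh G x"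
    using assms(1) nbh_commute[of x] by blast
  ultimately have nbh_x: "nbh G x = {v2} \<union> B \<union> S"
    using nbh_subset(1)[of x] V1_eq V2_eq unfolding S_def by auto
  have "arcs_ends G = symcl ({v1} \<times> nbh G v1 \<union> {x} \<times> nbh G x)"
    unfolding arcs_ends_eq_symcl V1_eq(1) by (rule arg_cong[of _ _ symcl]) auto
  also have "\<dots> = linked_stars v1 A v2 x B \<union> symcl ({x} \<times> S)"
    unfolding linked_stars_def nbh_v1 nbh_x by (auto simp: mem_symcl_iff)
  finally have arcs: "arcs_ends G = linked_stars v1 A v2 x B \<union> symcl ({x} \<times> S)" .
  have "S \<subseteq> linked_stars v1 A v2 x B `` {v1}"
    by (auto simp: S_def linked_stars_def mem_symcl_iff)
  moreover have "distinct [v1, v2, x]" "A \<inter> B = {}" "(A \<union> B) \<inter> {v1, v2, x} = {}"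
    using V1_eq v1_in v2_in v2_in_nbh near2_subset disjoint unfolding A_def B_def by auto
  moreover have "verts G = {v1, v2, x} \<union> A \<union> B"
    using verts_eq V1_eq V2_eq by blast
  moreover have "A \<noteq> {}" "B \<noteq> {}"
    using assms(3,4) by (simp_all add: A_def B_def)
  ultimately show ?thesis
    unfolding family_F1_def using arcs bipartition graph_axioms by blast
qed

lemma (in bipartite_edge) near_complete_imp_family_F2:
  assumes nonempty: "near1 \<noteq> {}" "near2 \<noteq> {}"
    and complete: "complete_to G far1 near2" "complete_to G far2 near1" "complete_to G near1 near2"
  shows "G \<in> family_F2"
proof -
  obtain x y where near: "x \<in> near1" "y \<in> near2" using nonempty by blast
  moreover have "complete_to G near2 near1"
    using complete(3) complete_to_commute by blast
  ultimately have "nbh G x = V2" "nbh G y = V1"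
    using complete(3) nbh_near2_eq_V1_iff[OF complete(1) near(2)]
      flip.nbh_near2_eq_V1_iff[OF complete(2) near(1)] by (simp_all add: complete_to_def)
  then show ?thesis
    using family_F2I near near2_subset flip.near2_subset by blast
qed

lemma (in bipartite_edge) near_singletons_imp_property_Im2:
  assumes near: "near1 = {b}" "near2 = {a}"
    and complete: "complete_to G far1 near2" "complete_to G far2 near1"
    and incomplete: "\<not> complete_to G near1 near2"
  shows "property_Im2 G V1 V2"
proof -
  have not_adjacent: "a \<notin> nbh G b" "b \<notin> nbh G a"
    using incomplete near nbh_commute[of a] by (simp_all add: complete_to_def)
  have members: "b \<in> near1" "a \<in> near2" using near by simp_all
  have "V1 - {b} \<subseteq> insert v1 far1" "V2 - {a} \<subseteq> insert v2 far2" using near by blast+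
  then have "nbh G a = V1 - {b}" "nbh G b = V2 - {a}"
    using not_adjacent nbh_near2_bounds[OF complete(1) members(2)]
      flip.nbh_near2_bounds[OF complete(2) members(1)] by blast+
  moreover have "b \<in> V1" "a \<in> V2" using members near2_subset flip.near2_subset by blast+
  ultimately show ?thesis
    using not_adjacent unfolding property_Im2_def mem_nbh by blast
qed

lemma (in bipartite_edge) saturated_imp_family:
  assumes saturated
  shows "G \<in> family_F1 \<union> family_F2 \<union> family_F3"
proof -
  have nonempty: "near1 \<noteq> {}" "near2 \<noteq> {}"
    and complete: "complete_to G far1 near2" "complete_to G far2 near1"
    using assms by (simp_all add: saturated_def)
  consider (near_complete) "complete_to G near1 near2"
    | (no_far) "far1 = {}" "far2 = {}"
    | (no_far1) "far1 = {}" "far2 \<noteq> {}" "card near1 = 1"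
    | (no_far2) "far2 = {}" "far1 \<noteq> {}" "card near2 = 1"
    | (near_singletons) "\<not> complete_to G near1 near2" "card near1 = 1" "card near2 = 1"
    using assms unfolding saturated_def by argo
  then show ?thesis
  proof cases
    case near_complete
    then show ?thesis using near_complete_imp_family_F2 nonempty complete by blast
  next
    case no_far
    then have "nbh G v1 = V2" "nbh G v2 = V1"
      using nbh_subset(1)[OF v1_in] nbh_subset(2)[OF v2_in] by blast+
    then show ?thesis using family_F2I[OF v1_in v2_in] by blast
  next
    case no_far1
    obtain x where "near1 = {x}" using no_far1(3) by (rule card_1_singletonE)
    then show ?thesis using family_F1I no_far1 nonempty complete by blast
  next
    case no_far2
    obtain x where "near2 = {x}" using no_far2(3) by (rule card_1_singletonE)
    then show ?thesis using flip.family_F1I no_far2 nonempty complete by blast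
  next
    case near_singletons
    obtain a b where "near1 = {b}" "near2 = {a}"
      using near_singletons(2,3) by (elim card_1_singletonE)
    then show ?thesis
      using near_singletons_imp_property_Im2 complete near_singletons(1) bipartition family_F3_iff
      by blast
  qed
qed

lemma (in graph) family_F1_imp_property_Im1:
  assumes "G \<in> family_F1"
  shows "\<exists>V1 V2. bipartition G V1 V2 \<and> property_Im1 G V1 V2"
proof -
  obtain v1 v2 x A B S where nonempty: "A \<noteq> {}" "B \<noteq> {}"
    and distinct: "distinct [v1, v2, x]" "A \<inter> B = {}" "(A \<union> B) \<inter> {v1, v2, x} = {}"
    and S: "S \<subseteq> linked_stars v1 A v2 x B `` {v1}"
    and verts: "verts G = {v1, v2, x} \<union> A \<union> B"
    and arcs: "arcs_ends G = linked_stars v1 A v2 x B \<union> symcl ({x} \<times> S)"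
    using assms unfolding family_F1_def by blast
  have S_subset: "S \<subseteq> insert v2 A"
    using S distinct by (auto simp: linked_stars_def mem_symcl_iff)
  define V1 where "V1 = {v1, x}"
  define V2 where "V2 = {v2} \<union> A \<union> B"
  have bipartite: "bipartition G V1 V2"
    unfolding bipartition_def verts arcs V1_def V2_def
    using distinct S_subset by (auto simp: linked_stars_def mem_symcl_iff)
  have nbh: "nbh G v1 = insert v2 A" "nbh G v2 = V1" "B \<subseteq> nbh G x"
    using distinct S_subset unfolding nbh_def arcs by (auto simp: linked_stars_def mem_symcl_iff V1_def)
  interpret bipartite_edge G V1 V2 v1 v2
    by unfold_locales (use bipartite nbh(1) in \<open>auto simp: V1_def V2_def mem_nbh[symmetric]\<close>)
  have near: "near1 = {x}" "near2 = A" "far1 = {}" "far2 = B"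
    using nbh distinct by (auto simp: V1_def V2_def)
  have "complete_to G B {x}"
    using nbh(3) nbh_commute[of x] by (auto simp: complete_to_def)
  then have saturated
    unfolding saturated_def near using nonempty by (simp add: complete_to_def)
  with bipartite show ?thesis using saturated_imp_property_Im1 by blast
qed

lemma (in bipartite_graph) property_Im1_imp_family:
  assumes "property_Im1 G V1 V2"
  shows "G \<in> family_F1 \<union> family_F2 \<union> family_F3"
proof -
  obtain v1 v2 where edge: "v1 \<in> V1" "v2 \<in> V2" "v1 \<rightarrow>\<^bsub>G\<^esub> v2"
    and maximal: "maximal_irredundant G {v1, v2}"
    using assms property_Im1_iff by blast
  interpret bipartite_edge G V1 V2 v1 v2 by unfold_locales (fact edge)+
  show ?thesis
    using maximal maximal_irredundant_edge_iff saturated_imp_family by blast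
qed

lemma (in bipartite_graph) dominating_pair_imp_property_Im1:
  assumes pair: "v1 \<in> V1" "v2 \<in> V2" "nbh G v1 = V2" "nbh G v2 = V1"
    and no_dominating_vertex: "\<not> (\<exists>v. maximal_irredundant G {v})"
  shows "property_Im1 G V1 V2"
proof -
  interpret bipartite_edge G V1 V2 v1 v2
    by unfold_locales (use pair in \<open>auto simp: mem_nbh[symmetric]\<close>)
  have nbh_neq: "nbh G v \<noteq> verts G - {v}" if "v \<in> verts G" for v
    using that no_dominating_vertex maximal_irredundant_singleton_iff by blast
  have "verts G - V1 = V2" "verts G - V2 = V1" "v1 \<in> verts G" "v2 \<in> verts G"
    using verts_eq disjoint pair(1,2) by auto
  then have "V1 \<noteq> {v1}" "V2 \<noteq> {v2}"
    using nbh_neq pair(3,4) by metis+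
  then have saturated
    using pair by (auto simp: saturated_def complete_to_def)
  then show ?thesis by (rule saturated_imp_property_Im1)
qed

lemma (in graph) property_Im_iff_family:
  assumes "\<not> complete_bipartite_digraph 1 (card (verts G) - 1) G"
  shows "(\<exists>V1 V2. bipartition G V1 V2 \<and> (property_Im1 G V1 V2 \<or> property_Im2 G V1 V2)) \<longleftrightarrow>
    G \<in> family_F1 \<union> family_F2 \<union> family_F3" (is "?L \<longleftrightarrow> ?R")
proof
  assume ?L
  then obtain V1 V2 where bipartite: "bipartition G V1 V2"
    and Im: "property_Im1 G V1 V2 \<or> property_Im2 G V1 V2" by blast
  interpret bipartite_graph G V1 V2 by unfold_locales fact
  show ?R using Im bipartite property_Im1_imp_family family_F3_iff by blast
next
  assume ?R
  then consider (F1) "G \<in> family_F1" | (F2) "G \<in> family_F2" | (F3) "G \<in> family_F3" by blast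
  then show ?L
  proof cases
    case F1
    then show ?thesis using family_F1_imp_property_Im1 by blast
  next
    case F2
    then obtain V1 V2 v1 v2 where bipartite: "bipartition G V1 V2"
      and pair: "v1 \<in> V1" "v2 \<in> V2" "nbh G v1 = V2" "nbh G v2 = V1"
      unfolding family_F2_def by blast
    interpret bipartite_graph G V1 V2 by unfold_locales fact
    have "property_Im1 G V1 V2"
      using dominating_pair_imp_property_Im1[OF pair] assms bipartite star_iff_maximal_irredundant_singleton by blast
    then show ?thesis using bipartite by blast
  next
    case F3
    then show ?thesis using family_F3_iff by blast
  qed
qed

lemma (in graph) irredundance_chromatic_number_eq_2_iff:
  assumes edge: "u \<rightarrow>\<^bsub>G\<^esub> v" and "\<not> complete_bipartite_digraph 1 (card (verts G) - 1) G"
  shows "\<chi>\<^sub>i G = 2 \<longleftrightarrow>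
    (\<exists>V1 V2. bipartition G V1 V2 \<and> (property_Im1 G V1 V2 \<or> property_Im2 G V1 V2))"
proof -
  have "(\<exists>R. maximal_irredundant G R \<and> inj_on (\<lambda>v. v \<in> V1) R) \<longleftrightarrow>
    property_Im1 G V1 V2 \<or> property_Im2 G V1 V2" if bipartite: "bipartition G V1 V2" for V1 V2
  proof -
    interpret bipartite_graph G V1 V2 by unfold_locales fact
    have "verts G \<noteq> {}" "\<not> (\<exists>v. maximal_irredundant G {v})"
      using adj_in_verts[OF edge] assms(2) bipartite star_iff_maximal_irredundant_singleton by blast+
    then show ?thesis
      using ex_maximal_irredundant_crossing_pair_iff property_Im1_iff property_Im2_iff by blast
  qed
  then have "\<chi>\<^sub>i G \<le> 2 \<longleftrightarrow>
    (\<exists>V1 V2. bipartition G V1 V2 \<and> (property_Im1 G V1 V2 \<or> property_Im2 G V1 V2))"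
    unfolding irredundance_chromatic_number_le_2_iff by blast
  moreover have "\<chi>\<^sub>i G = 2 \<longleftrightarrow> \<chi>\<^sub>i G \<le> 2"
    using irredundance_chromatic_number_ge_2[OF edge] by linarith
  ultimately show ?thesis by blast
qed

theorem theorem3:
  fixes G :: "('a, 'b) pre_digraph" and n :: nat
  assumes "graph G" and "Digraph_Component.connected G"
    and "card (verts G) = n" and "n \<ge> 2"
    and "\<forall>v\<in>verts G. nbh G v \<noteq> {}"
  shows "(2 \<le> \<chi>\<^sub>i G \<and> \<chi>\<^sub>i G \<le> n) \<and>
    (\<chi>\<^sub>i G = n \<longleftrightarrow> complete_digraph n G) \<and>
    (complete_bipartite_digraph 1 (n - 1) G \<longrightarrow> \<chi>\<^sub>i G = 2) \<and>
    (\<not> complete_bipartite_digraph 1 (n - 1) G \<longrightarrow>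
      (\<chi>\<^sub>i G = 2 \<longleftrightarrow>
        (\<exists>V1 V2. bipartition G V1 V2 \<and> (property_Im1 G V1 V2 \<or> property_Im2 G V1 V2))) \<and>
      ((\<exists>V1 V2. bipartition G V1 V2 \<and> (property_Im1 G V1 V2 \<or> property_Im2 G V1 V2)) \<longleftrightarrow>
        G \<in> family_F1 \<union> family_F2 \<union> family_F3))"
proof -
  interpret graph G by fact
  have nonempty: "verts G \<noteq> {}" using assms(3,4) by auto
  then obtain u v where "v \<in> nbh G u" using assms(5) by blast
  then have edge: "u \<rightarrow>\<^bsub>G\<^esub> v" by (simp add: mem_nbh)
  have "2 \<le> \<chi>\<^sub>i G" "\<chi>\<^sub>i G \<le> n"
    using irredundance_chromatic_number_ge_2[OF edge] irredundance_chromatic_number_le_order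
      assms(3) by simp_all
  moreover have "\<chi>\<^sub>i G = n \<longleftrightarrow> complete_digraph n G"
    using irredundance_chromatic_number_eq_order_iff[OF nonempty assms(5)] assms(3) by simp
  moreover have "complete_bipartite_digraph 1 (n - 1) G \<Longrightarrow> \<chi>\<^sub>i G = 2"
    using irredundance_chromatic_number_star_le_2 \<open>2 \<le> \<chi>\<^sub>i G\<close> assms(3) by simp
  ultimately show ?thesis
    using irredundance_chromatic_number_eq_2_iff[OF edge] property_Im_iff_family
    unfolding assms(3) by blast
qed

end
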